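(* For any odd prime $p$ and natural number $k$ such that $\gcd(p,k)=1$, a bijective function $f$ whose domain is $\mathbb{Z}_p\times\mathbb{Z}_{kp}$ and whose range is $\mathbb{Z}_{kp^2}$ can be defined as $$f((a,b))=ka+pb,$$ where $a\in\mathbb{Z}_p$ and $b\in\mathbb{Z}_{kp}$.
   Context: $\mathbb{Z}_m$ denotes the additive cyclic group of integers modulo $m$, and $\mathbb{Z}_p\times\mathbb{Z}_{kp}$ is the direct product with componentwise addition. In the formula, $a$ and $b$ are taken as their standard integer representatives, $a\in\{0,1,\dots,p-1\}$ and $b\in\{0,1,\dots,kp-1\}$, and $ka+pb$ is read modulo $kp^2$. The function $f$ is a map of sets, not assumed to be a homomorphism. *)

theory Defs
  imports "HOL-Algebra.Elementary_Groups" "HOL-Computational_Algebra.Primes"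
begin

text \<open>
  For \<open>m > 0\<close>, the carrier of \<^term>\<open>integer_mod_group m\<close> is the set of standard
  representatives \<open>{0..<m}\<close> (as integers), so \<open>a\<close> and \<open>b\<close> below are the integers
  entering the formula \<open>k a + p b\<close>, and \<open>mod\<close> yields the standard representative of its class
  modulo \<open>k p\<^sup>2\<close>.
\<close>

definition residue_pair_map :: "nat \<Rightarrow> nat \<Rightarrow> int \<times> int \<Rightarrow> int" where
  "residue_pair_map p k = (\<lambda>(a, b). (int k * a + int p * b) mod int (k * p\<^sup>2))"

end

theory Submission
  imports Defs
begin

text \<open>
  Both carriers have \<open>k p\<^sup>2\<close> elements, so injectivity suffices. If \<open>k a + p b\<close> and
  \<open>k a' + p b'\<close> agree modulo \<open>k p\<^sup>2\<close>, then reducing modulo \<open>p\<close> leaves \<open>k a \<equiv> k a'\<close>, and \<open>k\<close>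
  may be cancelled because it is coprime to \<open>p\<close>. Hence the standard representatives \<open>a\<close> and \<open>a'\<close>
  are equal, and what remains, \<open>p b \<equiv> p b'\<close> modulo \<open>p \<cdot> k p\<close>, says that \<open>b \<equiv> b'\<close>
  modulo \<open>k p\<close>. Since \<open>gcd p 0 = p \<noteq> 1\<close> for a prime \<open>p\<close>, the
  coprimality hypothesis also forces \<open>k > 0\<close>, so the carriers really are the finite intervals
  of standard representatives and can be counted.
\<close>

lemma residues_eq_if_dvd_diff:
  fixes x y m :: int
  assumes "x \<in> {0..<m}" and "y \<in> {0..<m}" and "m dvd x - y"
  shows "x = y"
  using assms by (metis atLeastLessThan_iff mod_eq_dvd_iff mod_pos_pos_trivial)

lemma inj_on_residue_pair_map:
  assumes "p > 0" and "coprime p k"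
  shows "inj_on (residue_pair_map p k) ({0..<int p} \<times> {0..<int (k * p)})"
proof (rule inj_onI, clarify)
  fix a b a' b' :: int
  assume a: "a \<in> {0..<int p}" "a' \<in> {0..<int p}"
    and b: "b \<in> {0..<int (k * p)}" "b' \<in> {0..<int (k * p)}"
    and eq: "residue_pair_map p k (a, b) = residue_pair_map p k (a', b')"
  have "int (k * p\<^sup>2) dvd (int k * a + int p * b) - (int k * a' + int p * b')"
    using eq by (simp add: residue_pair_map_def mod_eq_dvd_iff)
  then have dvd: "int p * int (k * p) dvd int k * (a - a') + int p * (b - b')"
    by (simp add: algebra_simps power2_eq_square)
  then have "int p dvd int k * (a - a') + int p * (b - b')"
    by (rule dvd_mult_left)
  then have "int p dvd int k * (a - a')"
    by (simp add: dvd_add_left_iff)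
  then have "int p dvd a - a'"
    using \<open>coprime p k\<close> by (simp add: coprime_dvd_mult_right_iff)
  then have "a = a'"
    using a residues_eq_if_dvd_diff by blast
  moreover have "int (k * p) dvd b - b'"
    using dvd \<open>a = a'\<close> \<open>p > 0\<close> by (simp only: diff_self mult_zero_right add_0_left) simp
  then have "b = b'"
    using b residues_eq_if_dvd_diff by blast
  ultimately show "a = a' \<and> b = b'"
    by simp
qed

theorem theorem4p3:
  fixes p k :: nat
  assumes "prime p" and "odd p" and "gcd p k = 1"
  shows "bij_betw (residue_pair_map p k)
           (carrier (integer_mod_group p \<times>\<times> integer_mod_group (k * p)))
           (carrier (integer_mod_group (k * p\<^sup>2)))"
proof -
  let ?A = "{0..<int p} \<times> {0..<int (k * p)}" and ?B = "{0..<int (k * p\<^sup>2)}"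
  have "p > 0"
    using \<open>prime p\<close> by (rule prime_gt_0_nat)
  have "k > 0"
    using assms(1,3) by (cases k) auto
  have inj: "inj_on (residue_pair_map p k) ?A"
    using \<open>p > 0\<close> assms(3) by (intro inj_on_residue_pair_map) (auto simp: coprime_iff_gcd_eq_1)
  have "residue_pair_map p k ` ?A = ?B"
  proof (rule card_subset_eq)
    have "int (k * p\<^sup>2) > 0"
      using \<open>p > 0\<close> \<open>k > 0\<close> by simp
    then show "residue_pair_map p k ` ?A \<subseteq> ?B"
      by (auto simp only: residue_pair_map_def case_prod_conv atLeastLessThan_iff
            intro!: pos_mod_sign pos_mod_bound)
    have "card ?A = p * (k * p)"
      by (simp only: card_cartesian_product card_atLeastLessThan_int diff_0_right nat_int)
    also have "\<dots> = card ?B"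
      by (simp only: card_atLeastLessThan_int diff_0_right nat_int power2_eq_square ac_simps)
    finally show "card (residue_pair_map p k ` ?A) = card ?B"
      by (simp only: card_image[OF inj])
  qed simp
  with inj have "bij_betw (residue_pair_map p k) ?A ?B"
    by (rule bij_betw_imageI)
  then show ?thesis
    using \<open>p > 0\<close> \<open>k > 0\<close> by (simp add: carrier_integer_mod_group DirProd_def)
qed

end
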